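(* Let $(X,Y,Z)\sim P_{X,Y,Z}$ on finite alphabets, and for $n\ge1$ let $(X^n,Y^n,Z^n)$ be $n$ i.i.d. repetitions of $(X,Y,Z)$. Then for every $n$, $$\hat{\Psi}(X;Y\|Z)=\frac1n\hat{\Psi}(X^n;Y^n\|Z^n).$$
   Context: All random variables have finite alphabets. $I$ denotes Shannon (conditional) mutual information. For any finite-alphabet triple $(A,B,C)$ define $$\hat{\Psi}(A;B\|C)\triangleq\min_{J}\; \big[I(A;B|J)+I(A,B;J|C)\big],$$ where the minimum is over all finite-alphabet random variables $J$ jointly distributed with $(A,B,C)$, i.e. over all conditional distributions $P_{J|A,B,C}$. *)

theory Defs
  imports "HOL-Probability.Probability"
begin

text \<open>
  Shannon conditional mutual information \<open>I(U;V|W)\<close>, logarithms to base \<open>b\<close>, of random variables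
  on the probability space \<open>\<Omega>\<close>. All alphabets are countable types with the discrete sigma-algebra,
  so every product of them carries the discrete sigma-algebra too.
\<close>

abbreviation cond_mutual_info ::
  "real \<Rightarrow> 'w pmf \<Rightarrow> ('w \<Rightarrow> 'u::countable) \<Rightarrow> ('w \<Rightarrow> 'v::countable) \<Rightarrow> ('w \<Rightarrow> 't::countable) \<Rightarrow> real"
where
  "cond_mutual_info b \<Omega> U V W \<equiv>
     prob_space.conditional_mutual_information (measure_pmf \<Omega>) b
       (count_space UNIV) (count_space UNIV) (count_space UNIV) U V W"

text \<open>
  Joint laws of \<open>(A,B,C,J)\<close> that extend the law \<open>P\<close> of \<open>(A,B,C)\<close> by a finite-alphabet \<open>J\<close>, i.e. all
  choices of a conditional law of \<open>J\<close>. The alphabet of \<open>J\<close> is an arbitrary finite set of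
  natural numbers, of any size; this loses no generality because mutual information is
  invariant under relabelling.
\<close>

definition finite_extensions ::
  "('a \<times> 'b \<times> 'c) pmf \<Rightarrow> ('a \<times> 'b \<times> 'c \<times> nat) pmf set"
where
  "finite_extensions P =
     {Q. map_pmf (\<lambda>(x, y, z, j). (x, y, z)) Q = P \<and>
         finite ((\<lambda>(x, y, z, j). j) ` set_pmf Q)}"

text \<open>
  The minimum is taken literally, as the least element of the set of achievable values and
  not as its infimum: \<open>LEAST\<close> is unspecified on a set of reals without a least element.
  Intended for laws \<open>P\<close> of finite support.
\<close>

definition psi_hat ::
  "real \<Rightarrow> ('a::countable \<times> 'b::countable \<times> 'c::countable) pmf \<Rightarrow> real"
where
  "psi_hat b P =
     (LEAST v. \<exists>Q \<in> finite_extensions P.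
        v = cond_mutual_info b Q (\<lambda>(x, y, z, j). x) (\<lambda>(x, y, z, j). y) (\<lambda>(x, y, z, j). j)
          + cond_mutual_info b Q (\<lambda>(x, y, z, j). (x, y)) (\<lambda>(x, y, z, j). j) (\<lambda>(x, y, z, j). z))"

text \<open>
  The law of \<open>(X\<^sup>n, Y\<^sup>n, Z\<^sup>n)\<close>: draw \<open>n\<close> independent triples from \<open>P\<close>, then regroup the list of
  triples into three lists of length \<open>n\<close>.
\<close>

definition iid_triple ::
  "nat \<Rightarrow> ('a \<times> 'b \<times> 'c) pmf \<Rightarrow> ('a list \<times> 'b list \<times> 'c list) pmf"
where
  "iid_triple n P =
     map_pmf (\<lambda>ts. (map (\<lambda>(x, y, z). x) ts, map (\<lambda>(x, y, z). y) ts, map (\<lambda>(x, y, z). z) ts))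
       (replicate_pmf n P)"

end

theory Submission
  imports Defs
begin

text \<open>
  Expand the objective into entropies,
  \<open>H(AJ) + H(BJ) - H(ABJ) - H(J) + H(ABC) + H(JC) - H(ABCJ) - H(C)\<close>.

  The minimum is attained on finite alphabets: up to a constant the objective is \<open>\<Sum>\<^sub>j G(v\<^sub>j)\<close>, where
  \<open>v\<^sub>j = P(\<cdot>, J = j)\<close> and \<open>G\<close> is continuous and positively homogeneous. The achievable values are
  therefore the fibre over \<open>P\<close> of the convex hull of the graph of \<open>G\<close> on the probability simplex, and
  that hull is compact.

  The minimum is additive over independent triples: independent copies of \<open>J\<close> give \<open>\<le>\<close>, and four
  instances of submodularity give \<open>\<ge>\<close>, using \<open>J\<close> as auxiliary variable for \<open>(A\<^sub>1, B\<^sub>1, C\<^sub>1)\<close> and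
  \<open>(J, A\<^sub>1, B\<^sub>1)\<close> for \<open>(A\<^sub>2, B\<^sub>2, C\<^sub>2)\<close>. In particular the minimum for the \<open>n\<close>-fold law is attained
  because the one for \<open>P\<close> is.
\<close>

section \<open>Entropy on finitely supported laws\<close>

text \<open>Written as an expectation over the common space, so that entropies of variables with
  different alphabets combine under one integral.\<close>

definition shannon :: "real \<Rightarrow> 'w pmf \<Rightarrow> ('w \<Rightarrow> 'u) \<Rightarrow> real" where
  "shannon b Q f = - measure_pmf.expectation Q (\<lambda>w. log b (pmf (map_pmf f Q) (f w)))"

lemma shannon_map_pmf: "shannon b (map_pmf h Q) f = shannon b Q (\<lambda>w. f (h w))"
  by (simp add: shannon_def map_pmf_comp)

lemma pmf_map_pmf_cong:
  assumes "\<And>w'. w' \<in> set_pmf Q \<Longrightarrow> f w' = u \<longleftrightarrow> g w' = v"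
  shows "pmf (map_pmf f Q) u = pmf (map_pmf g Q) v"
  unfolding pmf_map by (rule measure_pmf.finite_measure_eq_AE) (auto simp: AE_measure_pmf_iff assms)

text \<open>Entropy sees only the partition of the support induced by the variable. All regrouping
  and relabelling of tuples below rests on this.\<close>

lemma shannon_cong:
  assumes "\<And>w w'. w \<in> set_pmf Q \<Longrightarrow> w' \<in> set_pmf Q \<Longrightarrow> f w = f w' \<longleftrightarrow> g w = g w'"
  shows "shannon b Q f = shannon b Q g"
proof -
  have "pmf (map_pmf f Q) (f w) = pmf (map_pmf g Q) (g w)" if "w \<in> set_pmf Q" for w
    using assms that by (intro pmf_map_pmf_cong) metis
  then show ?thesis
    unfolding shannon_def by (auto intro!: integral_cong_AE simp: AE_measure_pmf_iff)
qed

lemma pmf_map_pos: "w \<in> set_pmf Q \<Longrightarrow> 0 < pmf (map_pmf f Q) (f w)"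
  by (simp add: pmf_positive)

lemma shannon_eq_sum:
  assumes "finite S" "f ` set_pmf Q \<subseteq> S"
  shows "shannon b Q f = - (\<Sum>u\<in>S. pmf (map_pmf f Q) u * log b (pmf (map_pmf f Q) u))"
proof -
  let ?L = "\<lambda>u. log b (pmf (map_pmf f Q) u)"
  have "measure_pmf.expectation Q (\<lambda>w. ?L (f w)) = measure_pmf.expectation (map_pmf f Q) ?L"
    by simp
  also have "\<dots> = (\<Sum>u\<in>S. ?L u * pmf (map_pmf f Q) u)"
    using assms by (intro integral_measure_pmf_real) auto
  finally show ?thesis
    by (simp add: shannon_def mult.commute)
qed

lemma sum_pmf_map_pmf:
  assumes "finite S" "f ` set_pmf Q \<subseteq> S"
  shows "(\<Sum>u\<in>S. pmf (map_pmf f Q) u) = 1"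
  using assms by (intro sum_pmf_eq_1) auto

text \<open>Marginalisation: on the support, the event \<open>k = c\<close> is the union of the
  fibres of \<open>g\<close> over the values that \<open>\<kappa>\<close> sends to
  \<open>c\<close>.\<close>

lemma pmf_map_pmf_fiber_sum:
  assumes "finite S" "g ` set_pmf Q \<subseteq> S"
    and "\<And>w. w \<in> set_pmf Q \<Longrightarrow> k w = c \<longleftrightarrow> \<kappa> (g w) = c"
  shows "(\<Sum>v | v \<in> S \<and> \<kappa> v = c. pmf (map_pmf g Q) v) = pmf (map_pmf k Q) c"
proof -
  have "(\<Sum>v | v \<in> S \<and> \<kappa> v = c. pmf (map_pmf g Q) v)
      = measure (map_pmf g Q) {v \<in> S. \<kappa> v = c}"
    using assms(1) by (subst measure_measure_pmf_finite) auto
  also have "\<dots> = measure Q (k -` {c})"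
    unfolding measure_map_pmf using assms(2,3)
    by (intro measure_pmf.finite_measure_eq_AE) (auto simp: AE_measure_pmf_iff)
  finally show ?thesis by (simp add: pmf_map)
qed

text \<open>
  \<open>h\<close> plays the role of the pair \<open>(f, g)\<close> and \<open>k\<close> that of a common function of \<open>f\<close> and \<open>g\<close>. Both are
  only required up to the partition they induce on the support, which spares the relabelling of tuples.
\<close>

lemma expectation_ratio_le_one:
  assumes fin: "finite (set_pmf Q)"
    and h: "\<And>w w'. w \<in> set_pmf Q \<Longrightarrow> w' \<in> set_pmf Q \<Longrightarrow> h w = h w' \<longleftrightarrow> f w = f w' \<and> g w = g w'"
    and kf: "\<And>w w'. w \<in> set_pmf Q \<Longrightarrow> w' \<in> set_pmf Q \<Longrightarrow> f w = f w' \<Longrightarrow> k w = k w'"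
    and kg: "\<And>w w'. w \<in> set_pmf Q \<Longrightarrow> w' \<in> set_pmf Q \<Longrightarrow> g w = g w' \<Longrightarrow> k w = k w'"
  shows "measure_pmf.expectation Q (\<lambda>w. pmf (map_pmf f Q) (f w) * pmf (map_pmf g Q) (g w) /
           (pmf (map_pmf h Q) (h w) * pmf (map_pmf k Q) (k w))) \<le> 1"
proof -
  define S where "S = set_pmf Q"
  \<comment> \<open>\<open>k\<close> is factored through \<open>f\<close> and through
    \<open>g\<close> by choosing representatives in the support; \<open>kf\<close> and
    \<open>kg\<close> make the choice immaterial.\<close>
  define \<kappa> where "\<kappa> u = k (SOME w. w \<in> S \<and> f w = u)" for u
  define \<mu> where "\<mu> v = k (SOME w. w \<in> S \<and> g w = v)" for v
  have \<kappa>: "\<kappa> (f w) = k w" if "w \<in> S" for w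
    unfolding \<kappa>_def using someI[of "\<lambda>w'. w' \<in> S \<and> f w' = f w" w] that
    by (intro kf) (simp_all add: S_def)
  have \<mu>: "\<mu> (g w) = k w" if "w \<in> S" for w
    unfolding \<mu>_def using someI[of "\<lambda>w'. w' \<in> S \<and> g w' = g w" w] that
    by (intro kg) (simp_all add: S_def)
  let ?p = "\<lambda>f. pmf (map_pmf f Q)"
  let ?fg = "\<lambda>w. (f w, g w)"
  let ?\<phi> = "\<lambda>(u, v). ?p f u * ?p g v / (?p ?fg (u, v) * ?p k (\<kappa> u))"
  have "?p h (h w) = ?p ?fg (?fg w)" if "w \<in> S" for w
    using h that unfolding S_def by (intro pmf_map_pmf_cong) auto
  then have "measure_pmf.expectation Q (\<lambda>w. ?p f (f w) * ?p g (g w) / (?p h (h w) * ?p k (k w)))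
      = measure_pmf.expectation Q (\<lambda>w. ?\<phi> (?fg w))"
    by (intro integral_cong_AE) (auto simp: AE_measure_pmf_iff \<kappa> S_def)
  also have "\<dots> = measure_pmf.expectation (map_pmf ?fg Q) ?\<phi>"
    by simp
  also have "\<dots> = (\<Sum>x\<in>?fg ` S. ?\<phi> x * ?p ?fg x)"
    using fin by (intro integral_measure_pmf_real) (auto simp: S_def)
  also have "\<dots> = (\<Sum>(u, v)\<in>?fg ` S. ?p f u * ?p g v / ?p k (\<kappa> u))"
  proof (rule sum.cong[OF refl])
    fix x assume "x \<in> ?fg ` S"
    then obtain w where w: "w \<in> S" "x = ?fg w" by auto
    then have "0 < ?p ?fg (?fg w)" by (intro pmf_map_pos) (simp add: S_def)
    then show "?\<phi> x * ?p ?fg x = (case x of (u, v) \<Rightarrow> ?p f u * ?p g v / ?p k (\<kappa> u))"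
      using w by simp
  qed
  \<comment> \<open>The only inequality: the sum passes from pairs of values that occur together to
    all pairs with a common value of \<open>k\<close>, and the added terms are nonnegative. For
    fixed \<open>u\<close> the admissible \<open>v\<close> have total mass
    \<open>?p k (\<kappa> u)\<close>, which cancels the denominator.\<close>
  also have "\<dots> \<le> (\<Sum>(u, v)\<in>Sigma (f ` S) (\<lambda>u. {v \<in> g ` S. \<mu> v = \<kappa> u}). ?p f u * ?p g v / ?p k (\<kappa> u))"
    using fin by (intro sum_mono2) (auto simp: S_def[symmetric] \<kappa> \<mu>)
  also have "\<dots> = (\<Sum>u\<in>f ` S. \<Sum>v | v \<in> g ` S \<and> \<mu> v = \<kappa> u. ?p f u * ?p g v / ?p k (\<kappa> u))"
    using fin by (subst sum.Sigma) (auto simp: S_def)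
  also have "\<dots> = (\<Sum>u\<in>f ` S. ?p f u)"
  proof (rule sum.cong[OF refl])
    fix u assume "u \<in> f ` S"
    then obtain w where w: "w \<in> S" "u = f w" by auto
    have "(\<Sum>v | v \<in> g ` S \<and> \<mu> v = \<kappa> u. ?p g v) = ?p k (\<kappa> u)"
      using fin by (intro pmf_map_pmf_fiber_sum) (auto simp: S_def[symmetric] \<mu>)
    moreover have "0 < ?p k (\<kappa> u)" using w by (auto simp: \<kappa> S_def intro: pmf_map_pos)
    ultimately show "(\<Sum>v | v \<in> g ` S \<and> \<mu> v = \<kappa> u. ?p f u * ?p g v / ?p k (\<kappa> u)) = ?p f u"
      by (simp add: sum_divide_distrib[symmetric] sum_distrib_left[symmetric])
  qed
  also have "\<dots> = 1"
    using fin by (intro sum_pmf_map_pmf) (auto simp: S_def)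
  finally show ?thesis .
qed

text \<open>This is \<open>I(f;g|k) \<ge> 0\<close>: apply \<open>ln r \<le> r - 1\<close> pointwise
  to the ratio whose expectation is at most 1 by \<open>expectation_ratio_le_one\<close>.\<close>

lemma shannon_submodular:
  assumes b: "b > 1" and fin: "finite (set_pmf Q)"
    and h: "\<And>w w'. w \<in> set_pmf Q \<Longrightarrow> w' \<in> set_pmf Q \<Longrightarrow> h w = h w' \<longleftrightarrow> f w = f w' \<and> g w = g w'"
    and kf: "\<And>w w'. w \<in> set_pmf Q \<Longrightarrow> w' \<in> set_pmf Q \<Longrightarrow> f w = f w' \<Longrightarrow> k w = k w'"
    and kg: "\<And>w w'. w \<in> set_pmf Q \<Longrightarrow> w' \<in> set_pmf Q \<Longrightarrow> g w = g w' \<Longrightarrow> k w = k w'"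
  shows "shannon b Q h + shannon b Q k \<le> shannon b Q f + shannon b Q g"
proof -
  let ?p = "\<lambda>f w. pmf (map_pmf f Q) (f w)"
  let ?r = "\<lambda>w. ?p f w * ?p g w / (?p h w * ?p k w)"
  let ?E = "measure_pmf.expectation Q"
  note [simp] = integrable_measure_pmf_finite[OF fin]
  have "log b (?p f w) + log b (?p g w) - log b (?p h w) - log b (?p k w) \<le> (?r w - 1) / ln b"
    if "w \<in> set_pmf Q" for w
  proof -
    note pos = pmf_map_pos[OF that, of f] pmf_map_pos[OF that, of g] pmf_map_pos[OF that, of h]
      pmf_map_pos[OF that, of k]
    have "log b (?p f w) + log b (?p g w) - log b (?p h w) - log b (?p k w) = ln (?r w) / ln b"
      using pos by (simp add: log_def ln_mult ln_div diff_divide_distrib add_divide_distrib)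
    also have "\<dots> \<le> (?r w - 1) / ln b"
      using pos b by (intro divide_right_mono ln_le_minus_one) auto
    finally show ?thesis .
  qed
  then have "?E (\<lambda>w. log b (?p f w) + log b (?p g w) - log b (?p h w) - log b (?p k w))
      \<le> ?E (\<lambda>w. (?r w - 1) / ln b)"
    by (intro integral_mono_AE) (auto simp: AE_measure_pmf_iff)
  also have "\<dots> = (?E ?r - 1) / ln b"
    by simp
  also have "\<dots> \<le> 0"
    using expectation_ratio_le_one[OF fin h kf kg] b by (intro divide_nonpos_nonneg) auto
  finally show ?thesis
    by (simp add: shannon_def)
qed

lemma shannon_indep:
  assumes b: "b > 1" and fin: "finite (set_pmf Q)"
    and map: "map_pmf (\<lambda>w. (f w, g w)) Q = pair_pmf P R"
  shows "shannon b Q (\<lambda>w. (f w, g w)) = shannon b Q f + shannon b Q g"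
proof -
  have f: "map_pmf f Q = P"
    using arg_cong[OF map, of "map_pmf fst"] by (simp add: map_pmf_comp map_fst_pair_pmf)
  have g: "map_pmf g Q = R"
    using arg_cong[OF map, of "map_pmf snd"] by (simp add: map_pmf_comp map_snd_pair_pmf)
  note [simp] = integrable_measure_pmf_finite[OF fin]
  have "measure_pmf.expectation Q (\<lambda>w. log b (pmf (pair_pmf P R) (f w, g w)))
     = measure_pmf.expectation Q (\<lambda>w. log b (pmf P (f w)) + log b (pmf R (g w)))"
    using pmf_map_pos[of _ Q f] pmf_map_pos[of _ Q g]
    by (intro integral_cong_AE) (auto simp: AE_measure_pmf_iff pmf_pair log_mult_pos f g)
  then show ?thesis
    by (simp add: shannon_def map f g)
qed

section \<open>Mutual information in terms of entropies\<close>

lemma distributed_map_pmf: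
  "distributed (measure_pmf Q) (count_space UNIV) X (\<lambda>x. ennreal (pmf (map_pmf X Q) x))"
  by (simp add: distributed_def map_pmf_rep_eq[symmetric] measure_pmf_eq_density[symmetric])

lemma mutual_information_eq_shannon:
  fixes X :: "'w \<Rightarrow> 'u::countable" and Y :: "'w \<Rightarrow> 'v::countable"
  assumes b: "b > 1" and fin: "finite (set_pmf Q)"
  shows "prob_space.mutual_information (measure_pmf Q) b (count_space UNIV) (count_space UNIV) X Y
     = shannon b Q X + shannon b Q Y - shannon b Q (\<lambda>w. (X w, Y w))"
proof -
  interpret information_space "measure_pmf Q" b
    by standard (rule b)
  \<comment> \<open>Countability makes the product sigma-algebra discrete, so the joint law has its
    point masses as density with respect to counting measure.\<close>
  have prod: "count_space UNIV \<Otimes>\<^sub>M count_space UNIV = (count_space UNIV :: ('u \<times> 'v) measure)"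
    by (simp add: pair_measure_countable)
  let ?XY = "\<lambda>w. (X w, Y w)"
  let ?L = "\<lambda>x. log b (pmf (map_pmf ?XY Q) x / (pmf (map_pmf X Q) (fst x) * pmf (map_pmf Y Q) (snd x)))"
  note [simp] = integrable_measure_pmf_finite[OF fin]
  have "prob_space.mutual_information (measure_pmf Q) b (count_space UNIV) (count_space UNIV) X Y
      = (\<integral>x. pmf (map_pmf ?XY Q) x * ?L x \<partial>count_space UNIV)"
    by (subst mutual_information_distr[OF _ _ distributed_map_pmf _ distributed_map_pmf, where Pxy = "pmf (map_pmf ?XY Q)"])
       (auto simp: prod distributed_map_pmf intro: sigma_finite_measure_count_space)
  also have "\<dots> = measure_pmf.expectation (map_pmf ?XY Q) ?L"
    by (subst measure_pmf_eq_density, subst integral_real_density) auto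
  also have "\<dots> = measure_pmf.expectation Q (\<lambda>w. ?L (?XY w))"
    by simp
  also have "\<dots> = measure_pmf.expectation Q (\<lambda>w. log b (pmf (map_pmf ?XY Q) (?XY w))
      - log b (pmf (map_pmf X Q) (X w)) - log b (pmf (map_pmf Y Q) (Y w)))"
    using pmf_map_pos[of _ Q X] pmf_map_pos[of _ Q Y] pmf_map_pos[of _ Q ?XY]
    by (intro integral_cong_AE)
       (auto simp: AE_measure_pmf_iff log_def ln_div ln_mult diff_divide_distrib add_divide_distrib
          less_imp_neq[symmetric])
  finally show ?thesis
    by (simp add: shannon_def)
qed

text \<open>The underlying definition is the difference \<open>I(U;(V,W)) - I(U;W)\<close>, in which
  the two copies of \<open>H(U)\<close> cancel.\<close>

lemma cond_mutual_info_eq_shannon: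
  fixes U :: "'w \<Rightarrow> 'u::countable" and V :: "'w \<Rightarrow> 'v::countable" and W :: "'w \<Rightarrow> 't::countable"
  assumes "b > 1" "finite (set_pmf Q)"
  shows "cond_mutual_info b Q U V W = shannon b Q (\<lambda>w. (U w, W w)) + shannon b Q (\<lambda>w. (V w, W w))
     - shannon b Q (\<lambda>w. (U w, V w, W w)) - shannon b Q W"
proof -
  have "count_space UNIV \<Otimes>\<^sub>M count_space UNIV = (count_space UNIV :: ('v \<times> 't) measure)"
    by (simp add: pair_measure_countable)
  then show ?thesis
    using assms unfolding prob_space.conditional_mutual_information_def[OF measure_pmf.prob_space_axioms]
    by (simp add: mutual_information_eq_shannon)
qed

section \<open>Additivity over independent triples\<close>

text \<open>The variables are arguments because additivity evaluates one law \<open>Q\<close> with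
  several choices of triple and auxiliary variable.\<close>

definition cost ::
  "real \<Rightarrow> 'w pmf \<Rightarrow> ('w \<Rightarrow> 'a) \<Rightarrow> ('w \<Rightarrow> 'b) \<Rightarrow> ('w \<Rightarrow> 'c) \<Rightarrow> ('w \<Rightarrow> 'j) \<Rightarrow> real"
where
  "cost b Q A B C J =
     shannon b Q (\<lambda>w. (A w, J w)) + shannon b Q (\<lambda>w. (B w, J w))
     - shannon b Q (\<lambda>w. (A w, B w, J w)) - shannon b Q J
     + shannon b Q (\<lambda>w. (A w, B w, C w)) + shannon b Q (\<lambda>w. (J w, C w))
     - shannon b Q (\<lambda>w. (A w, B w, C w, J w)) - shannon b Q C"

lemma cost_eq_cond_mutual_info:
  fixes A :: "'w \<Rightarrow> 'a::countable" and B :: "'w \<Rightarrow> 'b::countable" and C :: "'w \<Rightarrow> 'c::countable"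
    and J :: "'w \<Rightarrow> 'j::countable"
  assumes "b > 1" "finite (set_pmf Q)"
  shows "cost b Q A B C J =
    cond_mutual_info b Q A B J + cond_mutual_info b Q (\<lambda>w. (A w, B w)) J C"
proof -
  have "shannon b Q (\<lambda>w. ((A w, B w), C w)) = shannon b Q (\<lambda>w. (A w, B w, C w))"
    "shannon b Q (\<lambda>w. ((A w, B w), J w, C w)) = shannon b Q (\<lambda>w. (A w, B w, C w, J w))"
    by (auto intro!: shannon_cong)
  then show ?thesis
    using assms by (simp add: cond_mutual_info_eq_shannon cost_def)
qed

lemma cost_map_pmf:
  "cost b (map_pmf h Q) A B C J = cost b Q (\<lambda>w. A (h w)) (\<lambda>w. B (h w)) (\<lambda>w. C (h w)) (\<lambda>w. J (h w))"
  by (simp add: cost_def shannon_map_pmf)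

lemma cost_cong:
  assumes "\<And>w w'. w \<in> set_pmf Q \<Longrightarrow> w' \<in> set_pmf Q \<Longrightarrow> A w = A w' \<longleftrightarrow> A' w = A' w'"
    and "\<And>w w'. w \<in> set_pmf Q \<Longrightarrow> w' \<in> set_pmf Q \<Longrightarrow> B w = B w' \<longleftrightarrow> B' w = B' w'"
    and "\<And>w w'. w \<in> set_pmf Q \<Longrightarrow> w' \<in> set_pmf Q \<Longrightarrow> C w = C w' \<longleftrightarrow> C' w = C' w'"
    and "\<And>w w'. w \<in> set_pmf Q \<Longrightarrow> w' \<in> set_pmf Q \<Longrightarrow> J w = J w' \<longleftrightarrow> J' w = J' w'"
  shows "cost b Q A B C J = cost b Q A' B' C' J'"
  unfolding cost_def
  by (intro arg_cong2[where f="(+)"] arg_cong2[where f="(-)"] shannon_cong; simp only: prod.inject assms)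

text \<open>For a constant triple every term is either 0 or \<open>H(J)\<close>, and the copies of
  \<open>H(J)\<close> occur with opposite signs.\<close>

lemma cost_eq_0:
  assumes "\<And>w. w \<in> set_pmf Q \<Longrightarrow> A w = a" "\<And>w. w \<in> set_pmf Q \<Longrightarrow> B w = b"
    "\<And>w. w \<in> set_pmf Q \<Longrightarrow> C w = c"
  shows "cost r Q A B C J = 0"
proof -
  have "shannon r Q (\<lambda>_. ()) = 0"
    by (simp add: shannon_def)
  moreover have "shannon r Q (\<lambda>w. (A w, B w, C w)) = shannon r Q (\<lambda>_. ())"
    "shannon r Q C = shannon r Q (\<lambda>_. ())"
    "shannon r Q (\<lambda>w. (A w, J w)) = shannon r Q J"
    "shannon r Q (\<lambda>w. (B w, J w)) = shannon r Q J"
    "shannon r Q (\<lambda>w. (J w, C w)) = shannon r Q J"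
    "shannon r Q (\<lambda>w. (A w, B w, J w)) = shannon r Q J"
    "shannon r Q (\<lambda>w. (A w, B w, C w, J w)) = shannon r Q J"
    by (auto intro!: shannon_cong simp: assms)
  ultimately show ?thesis
    by (simp add: cost_def)
qed

text \<open>The difference of the two sides is exactly \<open>I(A2;B1|A1,J) + I(B2;A1|B1,J) +
  I(A1,B1;C2|J,C1) + I(A2,B2;C1|J,A1,B1,C2)\<close>; facts 1 to 4 give the nonnegativity of these
  terms in this order.\<close>

lemma cost_pair_ge:
  assumes b: "b > 1" and fin: "finite (set_pmf Q)"
    and indep: "map_pmf (\<lambda>w. ((A1 w, B1 w, C1 w), (A2 w, B2 w, C2 w))) Q = pair_pmf P R"
  shows "cost b Q A1 B1 C1 J + cost b Q A2 B2 C2 (\<lambda>w. (J w, A1 w, B1 w))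
     \<le> cost b Q (\<lambda>w. (A1 w, A2 w)) (\<lambda>w. (B1 w, B2 w)) (\<lambda>w. (C1 w, C2 w)) J"
proof -
  note sub = shannon_submodular[OF b fin]
  have 1: "shannon b Q (\<lambda>w. (A2 w, J w, A1 w, B1 w)) + shannon b Q (\<lambda>w. (A1 w, J w))
      \<le> shannon b Q (\<lambda>w. ((A1 w, A2 w), J w)) + shannon b Q (\<lambda>w. (A1 w, B1 w, J w))"
    by (rule sub) auto
  have 2: "shannon b Q (\<lambda>w. (B2 w, J w, A1 w, B1 w)) + shannon b Q (\<lambda>w. (B1 w, J w))
      \<le> shannon b Q (\<lambda>w. ((B1 w, B2 w), J w)) + shannon b Q (\<lambda>w. (A1 w, B1 w, J w))"
    by (rule sub) auto
  \<comment> \<open>Facts 3 and 4 share the entropy of \<open>(A1, B1, J, C1, C2)\<close>, which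
    occurs in none of the costs and cancels when they are added.\<close>
  have 3: "shannon b Q (\<lambda>w. (A1 w, B1 w, J w, C1 w, C2 w)) + shannon b Q (\<lambda>w. (J w, C1 w))
      \<le> shannon b Q (\<lambda>w. (J w, C1 w, C2 w)) + shannon b Q (\<lambda>w. (A1 w, B1 w, C1 w, J w))"
    by (rule sub) auto
  have 4: "shannon b Q (\<lambda>w. ((A1 w, A2 w), (B1 w, B2 w), (C1 w, C2 w), J w))
        + shannon b Q (\<lambda>w. ((J w, A1 w, B1 w), C2 w))
      \<le> shannon b Q (\<lambda>w. (A1 w, B1 w, J w, C1 w, C2 w))
        + shannon b Q (\<lambda>w. (A2 w, B2 w, C2 w, J w, A1 w, B1 w))"
    by (rule sub) auto
  have 5: "shannon b Q (\<lambda>w. (A2 w, B2 w, J w, A1 w, B1 w))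
      = shannon b Q (\<lambda>w. ((A1 w, A2 w), (B1 w, B2 w), J w))"
    by (rule shannon_cong) auto
  have 6: "shannon b Q (\<lambda>w. (J w, A1 w, B1 w)) = shannon b Q (\<lambda>w. (A1 w, B1 w, J w))"
    by (rule shannon_cong) auto
  \<comment> \<open>Independence enters only in facts 7 and 8, to split the two entropies that do
    not involve \<open>J\<close>.\<close>
  have "shannon b Q (\<lambda>w. ((A1 w, A2 w), (B1 w, B2 w), (C1 w, C2 w)))
      = shannon b Q (\<lambda>w. ((A1 w, B1 w, C1 w), (A2 w, B2 w, C2 w)))"
    by (rule shannon_cong) auto
  then have 7: "shannon b Q (\<lambda>w. ((A1 w, A2 w), (B1 w, B2 w), (C1 w, C2 w)))
      = shannon b Q (\<lambda>w. (A1 w, B1 w, C1 w)) + shannon b Q (\<lambda>w. (A2 w, B2 w, C2 w))"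
    using shannon_indep[OF b fin indep] by simp
  have "map_pmf (\<lambda>w. (C1 w, C2 w)) Q
      = map_pmf (\<lambda>(u, v). (snd (snd u), snd (snd v))) (pair_pmf P R)"
    unfolding indep[symmetric] by (simp add: map_pmf_comp)
  also have "\<dots> = pair_pmf (map_pmf (\<lambda>u. snd (snd u)) P) (map_pmf (\<lambda>v. snd (snd v)) R)"
    by (rule map_pair)
  finally have 8: "shannon b Q (\<lambda>w. (C1 w, C2 w)) = shannon b Q C1 + shannon b Q C2"
    by (rule shannon_indep[OF b fin])
  show ?thesis
    using 1 2 3 4 unfolding cost_def 5 6 7 8 by linarith
qed

lemma shannon_pair_pmf:
  assumes b: "b > 1" and fin: "finite (set_pmf Q)" "finite (set_pmf R)"
  shows "shannon b (pair_pmf Q R) (\<lambda>w. (f (fst w), g (snd w))) = shannon b Q f + shannon b R g"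
proof -
  have "shannon b (pair_pmf Q R) (\<lambda>w. (f (fst w), g (snd w)))
      = shannon b (pair_pmf Q R) (\<lambda>w. f (fst w)) + shannon b (pair_pmf Q R) (\<lambda>w. g (snd w))"
    using fin map_pair[of f g Q R] by (intro shannon_indep[OF b]) (auto simp: case_prod_beta')
  also have "\<dots> = shannon b (map_pmf fst (pair_pmf Q R)) f + shannon b (map_pmf snd (pair_pmf Q R)) g"
    by (simp only: shannon_map_pmf)
  finally show ?thesis
    by (simp add: map_fst_pair_pmf map_snd_pair_pmf)
qed

text \<open>Each of the eight entropies splits over the product space, so independently chosen
  auxiliaries add their costs; this supplies the upper bound.\<close>

lemma cost_pair_pmf:
  assumes b: "b > 1" and fin: "finite (set_pmf Q)" "finite (set_pmf R)"
  shows "cost b (pair_pmf Q R) (\<lambda>w. (A (fst w), A' (snd w))) (\<lambda>w. (B (fst w), B' (snd w)))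
      (\<lambda>w. (C (fst w), C' (snd w))) (\<lambda>w. (J (fst w), J' (snd w)))
    = cost b Q A B C J + cost b R A' B' C' J'"
proof -
  note pair = shannon_pair_pmf[OF b fin]
  let ?S = "pair_pmf Q R"
  have "shannon b ?S (\<lambda>w. ((A (fst w), A' (snd w)), J (fst w), J' (snd w)))
      = shannon b Q (\<lambda>w. (A w, J w)) + shannon b R (\<lambda>w. (A' w, J' w))"
    unfolding pair[symmetric] by (rule shannon_cong) auto
  moreover have "shannon b ?S (\<lambda>w. ((B (fst w), B' (snd w)), J (fst w), J' (snd w)))
      = shannon b Q (\<lambda>w. (B w, J w)) + shannon b R (\<lambda>w. (B' w, J' w))"
    unfolding pair[symmetric] by (rule shannon_cong) auto
  moreover have "shannon b ?S (\<lambda>w. ((A (fst w), A' (snd w)), (B (fst w), B' (snd w)), J (fst w), J' (snd w)))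
      = shannon b Q (\<lambda>w. (A w, B w, J w)) + shannon b R (\<lambda>w. (A' w, B' w, J' w))"
    unfolding pair[symmetric] by (rule shannon_cong) auto
  moreover have "shannon b ?S (\<lambda>w. ((A (fst w), A' (snd w)), (B (fst w), B' (snd w)), C (fst w), C' (snd w)))
      = shannon b Q (\<lambda>w. (A w, B w, C w)) + shannon b R (\<lambda>w. (A' w, B' w, C' w))"
    unfolding pair[symmetric] by (rule shannon_cong) auto
  moreover have "shannon b ?S (\<lambda>w. ((J (fst w), J' (snd w)), C (fst w), C' (snd w)))
      = shannon b Q (\<lambda>w. (J w, C w)) + shannon b R (\<lambda>w. (J' w, C' w))"
    unfolding pair[symmetric] by (rule shannon_cong) auto
  moreover have "shannon b ?S (\<lambda>w. ((A (fst w), A' (snd w)), (B (fst w), B' (snd w)), (C (fst w), C' (snd w)),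
        J (fst w), J' (snd w)))
      = shannon b Q (\<lambda>w. (A w, B w, C w, J w)) + shannon b R (\<lambda>w. (A' w, B' w, C' w, J' w))"
    unfolding pair[symmetric] by (rule shannon_cong) auto
  ultimately show ?thesis
    by (simp add: cost_def pair)
qed

section \<open>Minimum cost over finite extensions\<close>

abbreviation ext_cost :: "real \<Rightarrow> ('a \<times> 'b \<times> 'c \<times> nat) pmf \<Rightarrow> real" where
  "ext_cost b Q \<equiv> cost b Q (\<lambda>(x, y, z, j). x) (\<lambda>(x, y, z, j). y) (\<lambda>(x, y, z, j). z) (\<lambda>(x, y, z, j). j)"

text \<open>Attainment and lower bound are kept together, so that the induction over copies
  transports both; \<open>LEAST\<close> is evaluated only once a minimum is known.\<close>

definition is_min_cost :: "real \<Rightarrow> ('a \<times> 'b \<times> 'c) pmf \<Rightarrow> real \<Rightarrow> bool" where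
  "is_min_cost b P m \<longleftrightarrow>
     (\<exists>Q\<in>finite_extensions P. ext_cost b Q = m) \<and> (\<forall>Q\<in>finite_extensions P. m \<le> ext_cost b Q)"

lemma finite_extensions_finite:
  assumes "finite (set_pmf P)" "Q \<in> finite_extensions P"
  shows "finite (set_pmf Q)"
proof -
  let ?\<pi> = "\<lambda>(x, y, z, j). (x, y, z)" and ?j = "\<lambda>(x, y, z, j). j"
  have P: "set_pmf P = ?\<pi> ` set_pmf Q"
    using assms(2) unfolding finite_extensions_def
    by (metis (mono_tags, lifting) mem_Collect_eq set_map_pmf)
  have "set_pmf Q \<subseteq> (\<lambda>((x, y, z), j). (x, y, z, j)) ` (set_pmf P \<times> ?j ` set_pmf Q)"
    unfolding P by (auto simp: image_iff Bex_def split: prod.splits) blast+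
  then show ?thesis
    by (rule finite_subset) (use assms in \<open>auto simp: finite_extensions_def\<close>)
qed

lemma psi_hat_eq:
  fixes P :: "('a::countable \<times> 'b::countable \<times> 'c::countable) pmf"
  assumes b: "b > 1" and fin: "finite (set_pmf P)" and min: "is_min_cost b P m"
  shows "psi_hat b P = m"
proof -
  have "cond_mutual_info b Q (\<lambda>(x, y, z, j). x) (\<lambda>(x, y, z, j). y) (\<lambda>(x, y, z, j). j)
          + cond_mutual_info b Q (\<lambda>(x, y, z, j). (x, y)) (\<lambda>(x, y, z, j). j) (\<lambda>(x, y, z, j). z)
        = ext_cost b Q" if "Q \<in> finite_extensions P" for Q
    using cost_eq_cond_mutual_info[OF b finite_extensions_finite[OF fin that], of "\<lambda>(x, y, z, j). x"
      "\<lambda>(x, y, z, j). y" "\<lambda>(x, y, z, j). z" "\<lambda>(x, y, z, j). j"]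
    by (simp add: case_prod_beta')
  then show ?thesis
    using min unfolding psi_hat_def is_min_cost_def by (intro Least_equality) auto
qed

text \<open>Encoding by \<open>to_nat\<close> is injective and so leaves the cost unchanged. Tuples
  of variables may therefore serve as auxiliaries, although extensions only admit natural
  numbers.\<close>

lemma finite_extension_of_joint:
  fixes J :: "'w \<Rightarrow> 'j::countable"
  assumes fin: "finite (set_pmf Q)" and P: "map_pmf (\<lambda>w. (A w, B w, C w)) Q = P"
  shows "\<exists>Q'\<in>finite_extensions P. ext_cost b Q' = cost b Q A B C J"
proof
  let ?Q = "map_pmf (\<lambda>w. (A w, B w, C w, to_nat (J w))) Q"
  show "?Q \<in> finite_extensions P"
    using fin P by (auto simp: finite_extensions_def map_pmf_comp image_image)
  show "ext_cost b ?Q = cost b Q A B C J"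
    by (auto simp: cost_map_pmf intro!: cost_cong)
qed

lemma is_min_cost_le:
  fixes J :: "'w \<Rightarrow> 'j::countable"
  assumes "is_min_cost b P m" "finite (set_pmf Q)" "map_pmf (\<lambda>w. (A w, B w, C w)) Q = P"
  shows "m \<le> cost b Q A B C J"
  using finite_extension_of_joint[OF assms(2,3), of b J] assms(1) unfolding is_min_cost_def by force

section \<open>Induction on the number of copies\<close>

lemma iid_triple_0: "iid_triple 0 P = return_pmf ([], [], [])"
  by (simp add: iid_triple_def)

lemma iid_triple_Suc:
  "iid_triple (Suc n) P =
     map_pmf (\<lambda>((x, y, z), (xs, ys, zs)). (x # xs, y # ys, z # zs)) (pair_pmf P (iid_triple n P))"
proof -
  have "replicate_pmf (Suc n) P = map_pmf (\<lambda>(t, ts). t # ts) (pair_pmf P (replicate_pmf n P))"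
    by (simp add: pair_pmf_def map_bind_pmf)
  then show ?thesis
    by (simp add: iid_triple_def pair_map_pmf2 map_pmf_comp case_prod_beta' del: replicate_pmf.simps)
qed

lemma finite_iid_triple:
  assumes "finite (set_pmf P)"
  shows "finite (set_pmf (iid_triple n P))"
  by (induction n) (auto simp: iid_triple_0 iid_triple_Suc assms)

text \<open>The empty product is a constant triple, so all costs vanish. Starting here avoids a
  separate comparison of singleton lists with single letters.\<close>

lemma is_min_cost_iid_0: "is_min_cost b (iid_triple 0 P) 0"
proof -
  have "ext_cost b Q = 0" if "Q \<in> finite_extensions (iid_triple 0 P)"
    for Q :: "('a list \<times> 'b list \<times> 'c list \<times> nat) pmf"
  proof -
    have "set_pmf (map_pmf (\<lambda>(x, y, z, j). (x, y, z)) Q) = {([], [], [])}"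
      using that unfolding finite_extensions_def iid_triple_0 by simp
    moreover have "(x, y, z) \<in> set_pmf (map_pmf (\<lambda>(x, y, z, j). (x, y, z)) Q)"
      if "(x, y, z, j) \<in> set_pmf Q" for x y z j
      unfolding set_map_pmf by (rule image_eqI[OF _ that]) simp
    ultimately have "x = [] \<and> y = [] \<and> z = []" if "(x, y, z, j) \<in> set_pmf Q" for x y z j
      using that by (metis Pair_inject singletonD)
    then show ?thesis
      by (intro cost_eq_0[where a = "[]" and b = "[]" and c = "[]"]) (auto split: prod.splits)
  qed
  \<comment> \<open>A constant auxiliary shows that the value 0 is attained.\<close>
  moreover have "map_pmf (\<lambda>(x, y, z). (x, y, z, 0)) (iid_triple 0 P) \<in> finite_extensions (iid_triple 0 P)"
    by (simp add: finite_extensions_def iid_triple_0)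
  ultimately show ?thesis
    unfolding is_min_cost_def by (metis order_refl)
qed

text \<open>Heads and tails of the three lists form the two independent triples. The product of two
  optimal extensions attains the sum, and \<open>cost_pair_ge\<close> bounds every extension from
  below.\<close>

lemma is_min_cost_iid_Suc:
  fixes P :: "('a::countable \<times> 'b::countable \<times> 'c::countable) pmf"
  assumes b: "b > 1" and fin: "finite (set_pmf P)"
    and min: "is_min_cost b P m" and min': "is_min_cost b (iid_triple n P) m'"
  shows "is_min_cost b (iid_triple (Suc n) P) (m + m')"
  unfolding is_min_cost_def
proof
  obtain Q where Q: "Q \<in> finite_extensions P" "ext_cost b Q = m"
    using min unfolding is_min_cost_def by auto
  obtain R where R: "R \<in> finite_extensions (iid_triple n P)" "ext_cost b R = m'"
    using min' unfolding is_min_cost_def by auto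
  note fins = finite_extensions_finite[OF fin Q(1)] finite_extensions_finite[OF finite_iid_triple[OF fin] R(1)]
  let ?x = "\<lambda>(x, y, z, j). x" and ?y = "\<lambda>(x, y, z, j). y" and ?z = "\<lambda>(x, y, z, j). z" and ?j = "\<lambda>(x, y, z, j). j"
  let ?c = "\<lambda>p q w. p (fst w) # q (snd w)"
  have "\<exists>Q'\<in>finite_extensions (iid_triple (Suc n) P). ext_cost b Q' =
     cost b (pair_pmf Q R) (?c ?x ?x) (?c ?y ?y) (?c ?z ?z) (\<lambda>w. (?j (fst w), ?j (snd w)))"
  proof (rule finite_extension_of_joint)
    show "finite (set_pmf (pair_pmf Q R))" using fins by simp
    have "pair_pmf P (iid_triple n P)
       = map_pmf (\<lambda>(u, v). ((\<lambda>(x, y, z, j). (x, y, z)) u, (\<lambda>(x, y, z, j). (x, y, z)) v)) (pair_pmf Q R)"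
      using Q R unfolding map_pair by (simp add: finite_extensions_def)
    then show "map_pmf (\<lambda>w. (?c ?x ?x w, ?c ?y ?y w, ?c ?z ?z w)) (pair_pmf Q R) = iid_triple (Suc n) P"
      by (auto simp: iid_triple_Suc map_pmf_comp case_prod_beta' intro!: map_pmf_cong)
  qed
  \<comment> \<open>\<open>#\<close> is injective in both arguments, so consed lists and pairs
    induce the same partitions.\<close>
  also have "cost b (pair_pmf Q R) (?c ?x ?x) (?c ?y ?y) (?c ?z ?z) (\<lambda>w. (?j (fst w), ?j (snd w)))
     = cost b (pair_pmf Q R) (\<lambda>w. (?x (fst w), ?x (snd w))) (\<lambda>w. (?y (fst w), ?y (snd w)))
      (\<lambda>w. (?z (fst w), ?z (snd w))) (\<lambda>w. (?j (fst w), ?j (snd w)))"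
    by (rule cost_cong) simp_all
  also have "\<dots> = m + m'"
    using cost_pair_pmf[OF b fins, of ?x ?x ?y ?y ?z ?z ?j ?j] Q R by simp
  finally show "\<exists>Q\<in>finite_extensions (iid_triple (Suc n) P). ext_cost b Q = m + m'" .
next
  show "\<forall>Q\<in>finite_extensions (iid_triple (Suc n) P). m + m' \<le> ext_cost b Q"
  proof
    fix Q assume "Q \<in> finite_extensions (iid_triple (Suc n) P)"
    then have Q: "map_pmf (\<lambda>(x, y, z, j). (x, y, z)) Q = iid_triple (Suc n) P"
      and finQ: "finite (set_pmf Q)"
      by (simp add: finite_extensions_def, rule finite_extensions_finite[OF finite_iid_triple[OF fin]])
    define A B C J where ABCJ: "A = (\<lambda>(x::'a list, y::'b list, z::'c list, j::nat). x)"
      "B = (\<lambda>(x::'a list, y::'b list, z::'c list, j::nat). y)"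
      "C = (\<lambda>(x::'a list, y::'b list, z::'c list, j::nat). z)"
      "J = (\<lambda>(x::'a list, y::'b list, z::'c list, j::nat). j)"
    have Q': "map_pmf (\<lambda>w. (A w, B w, C w)) Q = iid_triple (Suc n) P"
      unfolding Q[symmetric] by (rule map_pmf_cong) (auto simp: ABCJ)
    \<comment> \<open>Only a nonempty list is determined by \<open>hd\<close> and \<open>tl\<close>;
      this justifies the final return from pairs to lists.\<close>
    have ne: "A w \<noteq> [] \<and> B w \<noteq> [] \<and> C w \<noteq> []" if "w \<in> set_pmf Q" for w
    proof -
      have "(A w, B w, C w) \<in> set_pmf (iid_triple (Suc n) P)"
        using that unfolding Q'[symmetric] by auto
      then show ?thesis by (auto simp: iid_triple_Suc)
    qed
    have indep: "map_pmf (\<lambda>w. ((hd (A w), hd (B w), hd (C w)), (tl (A w), tl (B w), tl (C w)))) Q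
        = pair_pmf P (iid_triple n P)" (is "?lhs = _")
    proof -
      have "?lhs = map_pmf (\<lambda>(xs, ys, zs). ((hd xs, hd ys, hd zs), (tl xs, tl ys, tl zs)))
          (map_pmf (\<lambda>w. (A w, B w, C w)) Q)"
        by (simp add: map_pmf_comp)
      also have "\<dots> = map_pmf (\<lambda>x. x) (pair_pmf P (iid_triple n P))"
        unfolding Q' iid_triple_Suc map_pmf_comp by (rule map_pmf_cong) auto
      finally show ?thesis by simp
    qed
    have P1: "map_pmf (\<lambda>w. (hd (A w), hd (B w), hd (C w))) Q = P"
      using arg_cong[OF indep, of "map_pmf fst"] by (simp add: map_pmf_comp map_fst_pair_pmf)
    have P2: "map_pmf (\<lambda>w. (tl (A w), tl (B w), tl (C w))) Q = iid_triple n P"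
      using arg_cong[OF indep, of "map_pmf snd"] by (simp add: map_pmf_comp map_snd_pair_pmf)
    have "m + m' \<le> cost b Q (\<lambda>w. hd (A w)) (\<lambda>w. hd (B w)) (\<lambda>w. hd (C w)) J
        + cost b Q (\<lambda>w. tl (A w)) (\<lambda>w. tl (B w)) (\<lambda>w. tl (C w)) (\<lambda>w. (J w, hd (A w), hd (B w)))"
      by (intro add_mono is_min_cost_le[OF min finQ P1] is_min_cost_le[OF min' finQ P2])
    also have "\<dots> \<le> cost b Q (\<lambda>w. (hd (A w), tl (A w))) (\<lambda>w. (hd (B w), tl (B w))) (\<lambda>w. (hd (C w), tl (C w))) J"
      by (rule cost_pair_ge[OF b finQ indep])
    also have "\<dots> = cost b Q A B C J"
      using ne by (intro cost_cong) (auto intro: list.expand)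
    finally show "m + m' \<le> ext_cost b Q" unfolding ABCJ .
  qed
qed

lemma is_min_cost_iid_triple:
  fixes P :: "('a::countable \<times> 'b::countable \<times> 'c::countable) pmf"
  assumes "b > 1" "finite (set_pmf P)" "is_min_cost b P m"
  shows "is_min_cost b (iid_triple n P) (real n * m)"
proof (induction n)
  case 0
  show ?case using is_min_cost_iid_0 by simp
next
  case (Suc n)
  show ?case using is_min_cost_iid_Suc[OF assms Suc] by (simp add: algebra_simps)
qed

section \<open>Existence of the minimum\<close>

text \<open>The unnormalised conditional law given \<open>J = j\<close>; keeping the mass
  \<open>P(J = j)\<close> avoids division by zero.\<close>

definition slice :: "('w::finite \<times> nat) pmf \<Rightarrow> nat \<Rightarrow> real ^ 'w" where
  "slice Q j = (\<chi> w. pmf Q (w, j))"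

definition slice_sum :: "(real ^ 'w::finite \<Rightarrow> real) \<Rightarrow> ('w \<times> nat) pmf \<Rightarrow> real" where
  "slice_sum G Q = (\<Sum>j\<in>snd ` set_pmf Q. G (slice Q j))"

abbreviation prob_simplex :: "(real ^ 'w::finite) set" where
  "prob_simplex \<equiv> {v. (\<forall>w. 0 \<le> v $ w) \<and> (\<Sum>w\<in>UNIV. v $ w) = 1}"

lemma slice_nonneg: "0 \<le> slice Q j $ w"
  by (simp add: slice_def)

lemma compact_simplex: "compact (prob_simplex :: (real ^ 'w::finite) set)"
proof -
  have "v \<in> cbox 0 1" if "v \<in> prob_simplex" for v :: "real ^ 'w"
  proof -
    have "v $ w \<le> (\<Sum>w\<in>UNIV. v $ w)" for w
      using that by (intro member_le_sum) auto
    then show ?thesis using that by (auto simp: mem_box_cart)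
  qed
  then have "bounded (prob_simplex :: (real ^ 'w) set)"
    using bounded_subset[OF bounded_cbox[of "0 :: real ^ 'w" 1], of prob_simplex] by blast
  moreover have "closed (prob_simplex :: (real ^ 'w) set)"
    by (intro closed_Collect_conj closed_Collect_all closed_Collect_le closed_Collect_eq continuous_intros)
  ultimately show ?thesis by (simp add: compact_eq_bounded_closed)
qed

lemma exists_pmf:
  assumes "finite S" "\<And>x. 0 \<le> f x" "\<And>x. x \<notin> S \<Longrightarrow> f x = 0" "sum f S = 1"
  shows "\<exists>Q. \<forall>x. pmf Q x = f x"
proof -
  have "(\<integral>\<^sup>+ x. ennreal (f x) \<partial>count_space UNIV) = (\<Sum>x\<in>S. ennreal (f x))"
    using assms by (intro nn_integral_count_space') auto
  also have "\<dots> = 1"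
    using assms by (simp add: sum_ennreal)
  finally show ?thesis
    using pmf_embed_pmf[of f] assms(2) by metis
qed

lemma pmf_map_fst:
  assumes "finite S" "snd ` set_pmf Q \<subseteq> S"
  shows "pmf (map_pmf fst Q) w = (\<Sum>j\<in>S. pmf Q (w, j))"
proof -
  have "pmf (map_pmf fst Q) w = measure Q (Pair w ` S)"
    unfolding pmf_map using assms(2)
    by (intro measure_pmf.finite_measure_eq_AE) (auto simp: AE_measure_pmf_iff)
  also have "\<dots> = (\<Sum>x\<in>Pair w ` S. pmf Q x)"
    using assms(1) by (intro measure_measure_pmf_finite) auto
  also have "\<dots> = (\<Sum>j\<in>S. pmf Q (w, j))"
    by (subst sum.reindex) (auto intro: inj_onI)
  finally show ?thesis .
qed

lemma slice_eq_0: "j \<notin> snd ` set_pmf Q \<Longrightarrow> slice Q j = 0"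
  by (auto simp: slice_def vec_eq_iff pmf_eq_0_set_pmf image_iff)

section \<open>Minimising sums of a homogeneous function over slices\<close>

locale homogeneous =
  fixes G :: "real ^ 'w::finite \<Rightarrow> real"
  assumes cont: "continuous_on {v. \<forall>w. 0 \<le> v $ w} G"
    and hom: "\<And>t v. 0 \<le> t \<Longrightarrow> (\<And>w. 0 \<le> v $ w) \<Longrightarrow> G (t *\<^sub>R v) = t * G v"
begin

abbreviation graph_hull :: "((real ^ 'w) \<times> real) set" where
  "graph_hull \<equiv> convex hull ((\<lambda>v. (v, G v)) ` prob_simplex)"

text \<open>Compactness of the convex hull of a compact set in finite dimension takes the place of a
  cardinality bound for the alphabet of \<open>J\<close>.\<close>

lemma compact_graph_hull: "compact graph_hull"
proof (intro compact_convex_hull compact_continuous_image compact_simplex continuous_intros)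
  show "continuous_on prob_simplex G"
    by (rule continuous_on_subset[OF cont]) auto
qed

lemma slice_sum_superset:
  assumes "finite S" "snd ` set_pmf Q \<subseteq> S"
  shows "slice_sum G Q = (\<Sum>j\<in>S. G (slice Q j))"
  \<comment> \<open>Homogeneity with factor 0 gives \<open>G 0 = 0\<close>, so values outside the
    support contribute nothing.\<close>
  unfolding slice_sum_def using assms hom[of 0 0]
  by (intro sum.mono_neutral_left) (auto simp: slice_eq_0)

lemma law_in_simplex: "(\<chi> w. pmf P w) \<in> prob_simplex"
  by (simp add: sum_pmf_eq_1)

text \<open>Each slice is its mass \<open>t j\<close> times a point \<open>u j\<close> of the
  simplex. The masses are convex weights, and homogeneity turns \<open>t j * G (u j)\<close> into
  \<open>G (slice Q j)\<close>.\<close>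

lemma slice_sum_in_hull:
  assumes fin: "finite (snd ` set_pmf Q)" and P: "map_pmf fst Q = P"
  shows "((\<chi> w. pmf P w), slice_sum G Q) \<in> graph_hull"
proof -
  let ?S = "snd ` set_pmf Q" and ?p = "\<chi> w. pmf P w"
  define t where "t j = (\<Sum>w\<in>UNIV. slice Q j $ w)" for j
  \<comment> \<open>For a slice of mass 0 any point of the simplex would do, since its weight is
    0.\<close>
  define u where "u j = (if t j = 0 then ?p else (1 / t j) *\<^sub>R slice Q j)" for j
  have t: "0 \<le> t j" for j
    by (simp add: t_def sum_nonneg slice_nonneg)
  have u: "u j \<in> prob_simplex" for j
  proof (cases "t j = 0")
    case True
    then show ?thesis using law_in_simplex[of P] by (simp add: u_def)
  next
    case False
    then show ?thesis
      using t[of j] by (simp add: u_def slice_nonneg sum_divide_distrib[symmetric]) (simp add: t_def)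
  qed
  have slice: "slice Q j = t j *\<^sub>R u j" for j
  proof (cases "t j = 0")
    case True
    then have "slice Q j = 0"
      by (simp add: t_def vec_eq_iff sum_nonneg_eq_0_iff slice_nonneg)
    then show ?thesis using True by simp
  next
    case False
    then show ?thesis by (simp add: u_def)
  qed
  have p: "?p = (\<Sum>j\<in>?S. slice Q j)"
    unfolding P[symmetric] by (simp add: vec_eq_iff pmf_map_fst[OF fin order_refl] slice_def)
  have "(\<Sum>j\<in>?S. t j) = (\<Sum>w\<in>UNIV. ?p $ w)"
    unfolding p t_def by (simp add: sum.swap[of _ ?S])
  also have "\<dots> = 1" using law_in_simplex[of P] by simp
  finally have "(\<Sum>j\<in>?S. t j *\<^sub>R (u j, G (u j))) \<in> graph_hull"
    using fin t u by (intro convex_sum) (auto intro!: hull_inc)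
  moreover have "(\<Sum>j\<in>?S. t j *\<^sub>R (u j, G (u j))) = (?p, slice_sum G Q)"
    unfolding p slice_sum_def using u by (auto simp: prod_eq_iff fst_sum snd_sum slice hom t)
  ultimately show ?thesis by simp
qed

lemma hull_point_is_slice_sum:
  assumes "((\<chi> w. pmf P w), r) \<in> graph_hull"
  shows "\<exists>Q. map_pmf fst Q = P \<and> finite (snd ` set_pmf Q) \<and> slice_sum G Q = r"
proof -
  obtain k t x where tx: "\<And>i. i \<in> {1::nat..k} \<Longrightarrow> 0 \<le> t i \<and> x i \<in> (\<lambda>v. (v, G v)) ` prob_simplex"
    and t1: "sum t {1..k} = 1" and eq: "(\<Sum>i = 1..k. t i *\<^sub>R x i) = ((\<chi> w. pmf P w), r)"
    using assms unfolding convex_hull_indexed by blast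
  define u where "u i = fst (x i)" for i
  have u: "u i \<in> prob_simplex" and x: "x i = (u i, G (u i))" if "i \<in> {1..k}" for i
    using tx[OF that] by (auto simp: u_def)
  have p: "(\<chi> w. pmf P w) = (\<Sum>i = 1..k. t i *\<^sub>R u i)"
    using arg_cong[OF eq, of fst] by (simp add: fst_sum u_def)
  have r: "r = (\<Sum>i = 1..k. t i * G (u i))"
    using arg_cong[OF eq, of snd] x by (simp add: snd_sum)
  \<comment> \<open>The index of the convex combination becomes the value of \<open>J\<close>:
    weights are its law, hull points the conditional laws.\<close>
  let ?f = "\<lambda>(w, j). if j \<in> {1..k} then t j * u j $ w else 0"
  have "(\<Sum>x\<in>UNIV \<times> {1..k}. ?f x) = (\<Sum>j = 1..k. \<Sum>w\<in>UNIV. t j * u j $ w)"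
    by (subst sum.cartesian_product[symmetric], subst sum.swap) simp
  also have "\<dots> = (\<Sum>j = 1..k. t j)"
    using u by (intro sum.cong) (auto simp: sum_distrib_left[symmetric])
  also note t1
  finally have "\<exists>Q. \<forall>x. pmf Q x = ?f x"
    using tx u by (intro exists_pmf[of "UNIV \<times> {1..k}"]) (auto split: prod.splits)
  then obtain Q where Q: "\<And>x. pmf Q x = ?f x"
    by blast
  have sub: "snd ` set_pmf Q \<subseteq> {1..k}"
    by (auto simp: set_pmf_iff Q split: if_splits)
  have slice: "slice Q j = t j *\<^sub>R u j" if "j \<in> {1..k}" for j
    using that by (simp add: slice_def Q vec_eq_iff)
  have "map_pmf fst Q = P"
  proof (rule pmf_eqI)
    fix w
    have "pmf P w = (\<Sum>i = 1..k. t i *\<^sub>R u i) $ w"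
      unfolding p[symmetric] by simp
    then show "pmf (map_pmf fst Q) w = pmf P w"
      by (simp add: pmf_map_fst[OF _ sub] Q)
  qed
  moreover have "slice_sum G Q = r"
    \<comment> \<open>Indices of weight 0 are missing from the support, hence the sum over the
      superset \<open>{1..k}\<close>.\<close>
    unfolding slice_sum_superset[OF _ sub, simplified] r using tx u
    by (intro sum.cong) (auto simp: slice hom)
  ultimately show ?thesis
    using finite_subset[OF sub] by blast
qed

lemma slice_sum_min_exists:
  "\<exists>Q. map_pmf fst Q = P \<and> finite (snd ` set_pmf Q) \<and>
     (\<forall>Q'. map_pmf fst Q' = P \<and> finite (snd ` set_pmf Q') \<longrightarrow> slice_sum G Q \<le> slice_sum G Q')"
proof -
  let ?p = "\<chi> w. pmf P w"
  \<comment> \<open>The achievable values for \<open>P\<close>, by the two preceding lemmas; the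
    point \<open>(?p, G ?p)\<close> below corresponds to a constant \<open>J\<close>.\<close>
  let ?R = "snd ` (graph_hull \<inter> {?p} \<times> UNIV)"
  have "compact ?R"
    by (intro compact_continuous_image compact_Int_closed compact_graph_hull closed_Times continuous_intros)
  moreover have "(?p, G ?p) \<in> graph_hull"
    using law_in_simplex[of P] by (intro hull_inc) auto
  then have "?R \<noteq> {}" by force
  ultimately obtain r where "r \<in> ?R" and min: "\<forall>r'\<in>?R. r \<le> r'"
    using compact_attains_inf[of ?R] by blast
  then obtain Q where Q: "map_pmf fst Q = P" "finite (snd ` set_pmf Q)" "slice_sum G Q = r"
    using hull_point_is_slice_sum[of P r] by auto
  have "slice_sum G Q \<le> slice_sum G Q'" if "map_pmf fst Q' = P" "finite (snd ` set_pmf Q')" for Q'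
    using slice_sum_in_hull[OF that(2,1)] min unfolding Q(3) by force
  then show ?thesis using Q by blast
qed

end

section \<open>The objective as a homogeneous function of slices\<close>

definition neg_entropy :: "real \<Rightarrow> ('w \<Rightarrow> 'u::finite) \<Rightarrow> real ^ 'w::finite \<Rightarrow> real" where
  "neg_entropy b f v = (\<Sum>u\<in>UNIV. let s = (\<Sum>w | f w = u. v $ w) in s * log b s)"

lemma continuous_on_x_log: "continuous_on {0..} (\<lambda>x::real. x * log b x)"
proof -
  \<comment> \<open>The delicate point is 0, where the value of the product is 0 whatever
    \<open>ln 0\<close> is. The limit follows from \<open>ln x / x\<close> at infinity by inverting
    \<open>x\<close>.\<close>
  have "((\<lambda>x. x * ln x) \<longlongrightarrow> 0 * ln 0) (at (0::real) within {0..})"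
  proof -
    have "((\<lambda>x::real. - (ln x / x)) \<longlongrightarrow> - 0) at_top"
      by (intro tendsto_minus ln_x_over_x_tendsto_0)
    moreover have "\<forall>\<^sub>F x in at_top. - (ln x / x) = inverse x * ln (inverse (x::real))"
      using eventually_gt_at_top[of "0::real"] by eventually_elim (simp add: ln_inverse divide_inverse)
    ultimately have "((\<lambda>x::real. inverse x * ln (inverse x)) \<longlongrightarrow> 0) at_top"
      using filterlim_cong[OF refl refl] by fastforce
    then have "((\<lambda>x::real. x * ln x) \<longlongrightarrow> 0) (at_right 0)"
      unfolding filterlim_at_right_to_top .
    moreover have "at (0::real) within {0..} = at_right 0"
      by (rule at_within_Ici_at_right)
    ultimately show ?thesis by simp
  qed
  moreover have "((\<lambda>x. x * ln x) \<longlongrightarrow> a * ln a) (at a within {0..})" if "0 < a" for a :: real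
    using that by (intro tendsto_intros) auto
  ultimately have "continuous_on {0..} (\<lambda>x::real. x * ln x)"
    unfolding continuous_on_def by (metis atLeast_iff less_eq_real_def)
  then have "continuous_on {0..} (\<lambda>x::real. x * ln x * (1 / ln b))"
    by (intro continuous_on_mult_right)
  then show ?thesis by (simp add: log_def)
qed

lemma continuous_on_neg_entropy: "continuous_on {v. \<forall>w. 0 \<le> v $ w} (neg_entropy b f)"
  unfolding neg_entropy_def Let_def
  by (intro continuous_on_sum continuous_on_compose2[OF continuous_on_x_log] continuous_intros)
     (auto intro: sum_nonneg)

text \<open>
  The second term depends on neither \<open>f\<close> nor its alphabet, so it cancels in combinations of
  \<open>neg_entropy\<close> terms whose coefficients add up to 0, such as \<open>gap\<close> below.
\<close>

lemma neg_entropy_scale: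
  assumes t: "0 \<le> t" and v: "\<And>w. 0 \<le> v $ w"
  shows "neg_entropy b f (t *\<^sub>R v) = t * neg_entropy b f v + t * log b t * (\<Sum>w\<in>UNIV. v $ w)"
proof -
  let ?s = "\<lambda>u. \<Sum>w | f w = u. v $ w"
  have "t * s * log b (t * s) = t * (s * log b s) + t * log b t * s" if "0 \<le> s" for s
    using t that by (cases "t = 0 \<or> s = 0") (auto simp: log_mult_pos algebra_simps)
  then have "neg_entropy b f (t *\<^sub>R v) = (\<Sum>u\<in>UNIV. t * (?s u * log b (?s u)) + t * log b t * ?s u)"
    unfolding neg_entropy_def using v by (auto simp: Let_def sum_distrib_left[symmetric] sum_nonneg intro!: sum.cong)
  also have "\<dots> = t * neg_entropy b f v + t * log b t * (\<Sum>u\<in>UNIV. ?s u)"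
    by (simp add: neg_entropy_def Let_def sum.distrib sum_distrib_left)
  also have "(\<Sum>u\<in>UNIV. ?s u) = (\<Sum>w\<in>UNIV. v $ w)"
    using sum.group[of UNIV UNIV f "\<lambda>w. v $ w"] by simp
  finally show ?thesis .
qed

text \<open>Since slices are unnormalised, their terms \<open>s * log b s\<close> run over the point
  masses of the pair of \<open>f\<close> and \<open>J\<close>, giving the joint entropy and not the
  conditional one.\<close>

lemma shannon_slices:
  fixes Q :: "('w::finite \<times> nat) pmf"
  assumes fin: "finite (snd ` set_pmf Q)"
  shows "shannon b Q (\<lambda>x. (f (fst x), snd x)) = - slice_sum (neg_entropy b f) Q"
proof -
  let ?g = "\<lambda>x. (f (fst x), snd x)" and ?S = "snd ` set_pmf Q"
  have pmf: "pmf (map_pmf ?g Q) (u, j) = (\<Sum>w | f w = u. slice Q j $ w)" for u j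
  proof -
    have "?g -` {(u, j)} = (\<lambda>w. (w, j)) ` {w. f w = u}" by auto
    then have "pmf (map_pmf ?g Q) (u, j) = sum (pmf Q) ((\<lambda>w. (w, j)) ` {w. f w = u})"
      by (simp add: pmf_map measure_measure_pmf_finite)
    also have "\<dots> = (\<Sum>w | f w = u. slice Q j $ w)"
      by (subst sum.reindex) (auto intro: inj_onI simp: slice_def)
    finally show ?thesis .
  qed
  have "shannon b Q ?g = - (\<Sum>x\<in>UNIV \<times> ?S. pmf (map_pmf ?g Q) x * log b (pmf (map_pmf ?g Q) x))"
    using fin by (intro shannon_eq_sum) auto
  also have "\<dots> = - (\<Sum>u\<in>UNIV. \<Sum>j\<in>?S. pmf (map_pmf ?g Q) (u, j) * log b (pmf (map_pmf ?g Q) (u, j)))"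
    by (subst sum.cartesian_product) (simp add: case_prod_beta')
  also have "\<dots> = - slice_sum (neg_entropy b f) Q"
    unfolding pmf slice_sum_def neg_entropy_def Let_def by (subst sum.swap) simp
  finally show ?thesis .
qed

text \<open>One slice's share of the six entropies that involve \<open>J\<close>; the other two,
  \<open>H(ABC)\<close> and \<open>H(C)\<close>, are fixed by \<open>P\<close>.\<close>

definition gap :: "real \<Rightarrow> real ^ ('a::finite \<times> 'b::finite \<times> 'c::finite) \<Rightarrow> real" where
  "gap b v = neg_entropy b (\<lambda>(x, y, z). (x, y)) v + neg_entropy b (\<lambda>_. ()) v + neg_entropy b (\<lambda>w. w) v
     - neg_entropy b (\<lambda>(x, y, z). x) v - neg_entropy b (\<lambda>(x, y, z). y) v - neg_entropy b (\<lambda>(x, y, z). z) v"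

lemma homogeneous_gap: "homogeneous (gap b)"
proof
  show "continuous_on {v. \<forall>w. 0 \<le> v $ w} (gap b)"
    unfolding gap_def by (intro continuous_intros continuous_on_neg_entropy)
  show "gap b (t *\<^sub>R v) = t * gap b v" if "0 \<le> t" "\<And>w. 0 \<le> v $ w" for t v
    using that by (simp add: gap_def neg_entropy_scale algebra_simps)
qed

lemma cost_eq_slice_sum:
  fixes Q :: "(('a::finite \<times> 'b::finite \<times> 'c::finite) \<times> nat) pmf"
  assumes fin: "finite (snd ` set_pmf Q)" and P: "map_pmf fst Q = P"
  shows "cost b Q (\<lambda>((x, y, z), j). x) (\<lambda>((x, y, z), j). y) (\<lambda>((x, y, z), j). z) snd
    = shannon b P (\<lambda>w. w) - shannon b P (\<lambda>(x, y, z). z) + slice_sum (gap b) Q"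
proof -
  let ?x = "\<lambda>((x, y, z), j). x" and ?y = "\<lambda>((x, y, z), j). y" and ?z = "\<lambda>((x, y, z), j). z"
  note slices = shannon_slices[OF fin, of b]
  have "shannon b Q (\<lambda>w. (?x w, snd w)) = - slice_sum (neg_entropy b (\<lambda>(x, y, z). x)) Q"
    unfolding slices[symmetric] by (rule shannon_cong) auto
  moreover have "shannon b Q (\<lambda>w. (?y w, snd w)) = - slice_sum (neg_entropy b (\<lambda>(x, y, z). y)) Q"
    unfolding slices[symmetric] by (rule shannon_cong) auto
  moreover have "shannon b Q (\<lambda>w. (snd w, ?z w)) = - slice_sum (neg_entropy b (\<lambda>(x, y, z). z)) Q"
    unfolding slices[symmetric] by (rule shannon_cong) auto
  moreover have "shannon b Q (\<lambda>w. (?x w, ?y w, snd w)) = - slice_sum (neg_entropy b (\<lambda>(x, y, z). (x, y))) Q"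
    unfolding slices[symmetric] by (rule shannon_cong) auto
  moreover have "shannon b Q snd = - slice_sum (neg_entropy b (\<lambda>_. ())) Q"
    unfolding slices[symmetric] by (rule shannon_cong) auto
  moreover have "shannon b Q (\<lambda>w. (?x w, ?y w, ?z w, snd w)) = - slice_sum (neg_entropy b (\<lambda>w. w)) Q"
    unfolding slices[symmetric] by (rule shannon_cong) auto
  moreover have "shannon b Q (\<lambda>w. (?x w, ?y w, ?z w)) = shannon b P (\<lambda>w. w)"
    unfolding P[symmetric] shannon_map_pmf by (rule shannon_cong) auto
  moreover have "shannon b Q ?z = shannon b P (\<lambda>(x, y, z). z)"
    unfolding P[symmetric] shannon_map_pmf by (rule shannon_cong) auto
  ultimately show ?thesis
    by (simp add: cost_def slice_sum_def gap_def sum.distrib sum_subtractf)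
qed

text \<open>Cost and slice sum differ by a constant determined by \<open>P\<close>, so a minimiser
  carries over after regrouping \<open>((x, y, z), j)\<close> as \<open>(x, y, z, j)\<close>. Finite
  types are needed to form \<open>real ^ 'w\<close>; laws on lists are reached through
  \<open>is_min_cost_iid_triple\<close>.\<close>

lemma is_min_cost_exists:
  fixes P :: "('a::finite \<times> 'b::finite \<times> 'c::finite) pmf"
  shows "\<exists>m. is_min_cost b P m"
proof -
  interpret homogeneous "gap b :: real ^ ('a \<times> 'b \<times> 'c) \<Rightarrow> real"
    by (rule homogeneous_gap)
  obtain Q where Q: "map_pmf fst Q = P" "finite (snd ` set_pmf Q)"
    and min: "\<And>Q'. map_pmf fst Q' = P \<Longrightarrow> finite (snd ` set_pmf Q') \<Longrightarrow>
      slice_sum (gap b) Q \<le> slice_sum (gap b) Q'"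
    using slice_sum_min_exists[of P] by blast
  let ?x = "\<lambda>((x, y, z), j). x" and ?y = "\<lambda>((x, y, z), j). y" and ?z = "\<lambda>((x, y, z), j). z"
  have "finite (set_pmf Q)"
    by (rule finite_subset[of _ "UNIV \<times> snd ` set_pmf Q"]) (use Q in \<open>force+\<close>)
  moreover have "map_pmf (\<lambda>w. (?x w, ?y w, ?z w)) Q = P"
    unfolding Q(1)[symmetric] by (rule map_pmf_cong) auto
  ultimately obtain Q1 where Q1: "Q1 \<in> finite_extensions P" "ext_cost b Q1 = cost b Q ?x ?y ?z snd"
    using finite_extension_of_joint by blast
  have "ext_cost b Q1 \<le> ext_cost b R" if R: "R \<in> finite_extensions P" for R
  proof -
    let ?R = "map_pmf (\<lambda>(x, y, z, j). ((x, y, z), j)) R"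
    have "map_pmf fst ?R = map_pmf (\<lambda>(x, y, z, j). (x, y, z)) R"
      unfolding map_pmf_comp by (rule map_pmf_cong) auto
    then have R1: "map_pmf fst ?R = P"
      using R by (simp add: finite_extensions_def)
    have "snd ` set_pmf ?R = (\<lambda>(x, y, z, j). j) ` set_pmf R"
      unfolding set_map_pmf image_image by (rule image_cong) auto
    then have R2: "finite (snd ` set_pmf ?R)"
      using R by (simp add: finite_extensions_def)
    have "ext_cost b R = cost b ?R ?x ?y ?z snd"
      unfolding cost_map_pmf by (rule cost_cong) auto
    then show ?thesis
      using min[OF R1 R2] by (simp add: Q1 cost_eq_slice_sum[OF R2 R1] cost_eq_slice_sum[OF Q(2,1)])
  qed
  then show ?thesis
    using Q1(1) unfolding is_min_cost_def by blast
qed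

theorem proposition2:
  fixes P :: "('a::finite \<times> 'b::finite \<times> 'c::finite) pmf"
    and n :: nat and b :: real
  assumes "b > 1" and "n \<ge> 1"
  shows "psi_hat b P = 1 / real n * psi_hat b (iid_triple n P)"
proof -
  obtain m where m: "is_min_cost b P m"
    using is_min_cost_exists by blast
  have "psi_hat b P = m"
    using assms(1) m by (intro psi_hat_eq) auto
  moreover have "psi_hat b (iid_triple n P) = real n * m"
    using assms(1) m by (intro psi_hat_eq is_min_cost_iid_triple finite_iid_triple) auto
  ultimately show ?thesis
    using assms(2) by simp
qed

end
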